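(* Let $t>0$ be a real number and let $G_t$ be the Zariski closure of $\phi_t(\Gamma)$ in $\mathrm{SL}(4,\mathbf{R})$. If $t\neq 1/2$, then $G_t=\mathrm{SL}(4,\mathbf{R})$. In particular, for $t\neq 1/2$, $\phi_t(\Gamma)$ is Zariski dense in $\mathrm{SL}(4,\mathbf{R})$.
   Context: $\Gamma$ is the fundamental group of the figure-eight knot complement, with presentation $\Gamma=\langle x,y\mid wx=yw\rangle$, $w=x^{-1}yxy^{-1}$. For $t\neq 0$, the representation $\phi_t:\Gamma\to \mathrm{SL}(4,\mathbf{R})$ is given by $$\phi_t(x)=\begin{pmatrix}1&0&1&t-1\\0&1&1&t\\0&0&1&t+\tfrac12\\0&0&0&1\end{pmatrix},\qquad \phi_t(y)=\begin{pmatrix}1&0&0&0\\2+\tfrac1t&1&0&0\\2&1&1&0\\1&1&0&1\end{pmatrix}.$$ At $t=1/2$, $\phi_t$ corresponds to the holonomy of the complete hyperbolic structure. *)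

theory Defs
  imports "HOL-Analysis.Analysis" "HOL-Algebra.Group"
begin

section \<open>Groups given by generators and relations\<close>

text \<open>A letter \<open>(g, True)\<close> stands for the generator \<open>g\<close>, and \<open>(g, False)\<close> for its formal
  inverse.  A relation \<open>u = v\<close> is given by the pair \<open>(u, v)\<close>.\<close>

type_synonym 'g word = "('g \<times> bool) list"

inductive pres_eq :: "('g word \<times> 'g word) set \<Rightarrow> 'g word \<Rightarrow> 'g word \<Rightarrow> bool"
  for R where
    refl: "pres_eq R u u"
  | sym: "pres_eq R u v \<Longrightarrow> pres_eq R v u"
  | trans: "pres_eq R u v \<Longrightarrow> pres_eq R v w \<Longrightarrow> pres_eq R u w"
  | append: "pres_eq R u u' \<Longrightarrow> pres_eq R v v' \<Longrightarrow> pres_eq R (u @ v) (u' @ v')"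
  | cancel: "pres_eq R [(g, b), (g, \<not> b)] []"
  | relation: "(u, v) \<in> R \<Longrightarrow> pres_eq R u v"

definition word_class :: "('g word \<times> 'g word) set \<Rightarrow> 'g word \<Rightarrow> 'g word set" where
  "word_class R u = {v. pres_eq R u v}"

definition presented_group :: "('g word \<times> 'g word) set \<Rightarrow> 'g word set monoid" where
  "presented_group R =
     \<lparr>carrier = range (word_class R),
      monoid.mult = (\<lambda>A B. \<Union>a\<in>A. \<Union>b\<in>B. word_class R (a @ b)),
      one = word_class R []\<rparr>"

fun word_eval :: "('a, 'm) monoid_scheme \<Rightarrow> ('g \<Rightarrow> 'a) \<Rightarrow> 'g word \<Rightarrow> 'a" where
  "word_eval G f [] = \<one>\<^bsub>G\<^esub>"
| "word_eval G f ((g, b) # u) = (if b then f g else inv\<^bsub>G\<^esub> f g) \<otimes>\<^bsub>G\<^esub> word_eval G f u"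

text \<open>The homomorphism out of a presented group determined by the images of the generators; it is
  meaningful when \<open>f\<close> respects the relations, for then \<open>word_eval G f\<close> is constant on each
  class.\<close>

definition presented_hom :: "('a, 'm) monoid_scheme \<Rightarrow> ('g \<Rightarrow> 'a) \<Rightarrow> 'g word set \<Rightarrow> 'a" where
  "presented_hom G f C = the_elem (word_eval G f ` C)"

lemma word_class_eq_iff: "word_class R u = word_class R v \<longleftrightarrow> pres_eq R u v"
  unfolding word_class_def set_eq_iff mem_Collect_eq
  by (meson pres_eq.refl pres_eq.sym pres_eq.trans)

lemma presented_group_mult:
  "word_class R u \<otimes>\<^bsub>presented_group R\<^esub> word_class R v = word_class R (u @ v)"
proof -
  have "word_class R (a @ b) = word_class R (u @ v)"
    if "a \<in> word_class R u" "b \<in> word_class R v" for a b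
  proof -
    have "pres_eq R u a" "pres_eq R v b"
      using that by (simp_all add: word_class_def)
    then show ?thesis
      unfolding word_class_eq_iff by (rule pres_eq.append[THEN pres_eq.sym])
  qed
  moreover have "u \<in> word_class R u" "v \<in> word_class R v"
    by (simp_all add: word_class_def pres_eq.refl)
  ultimately have "(\<Union>a\<in>word_class R u. \<Union>b\<in>word_class R v. word_class R (a @ b))
      = word_class R (u @ v)"
    by blast
  then show ?thesis
    by (simp add: presented_group_def)
qed

lemma pres_eq_left_inverse:
  "pres_eq R (rev (map (\<lambda>(g, b). (g, \<not> b)) u) @ u) []"
proof (induction u)
  case Nil
  show ?case by (simp add: pres_eq.refl)
next
  case (Cons a u)
  obtain g b where a: "a = (g, b)" by force
  let ?v = "rev (map (\<lambda>(g, b). (g, \<not> b)) u)"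
  have "pres_eq R ([(g, \<not> b), (g, \<not> \<not> b)] @ u) ([] @ u)"
    by (rule pres_eq.append[OF pres_eq.cancel pres_eq.refl])
  then have "pres_eq R ([(g, \<not> b), (g, b)] @ u) u"
    by simp
  then have "pres_eq R (?v @ ([(g, \<not> b), (g, b)] @ u)) (?v @ u)"
    by (rule pres_eq.append[OF pres_eq.refl])
  then have "pres_eq R (?v @ ([(g, \<not> b), (g, b)] @ u)) []"
    using Cons.IH by (rule pres_eq.trans)
  then show ?case
    by (simp add: a)
qed

lemma group_presented_group: "group (presented_group R)"
proof -
  have one: "\<one>\<^bsub>presented_group R\<^esub> = word_class R []"
    by (simp add: presented_group_def)
  show ?thesis
  proof (rule groupI)
    fix A assume "A \<in> carrier (presented_group R)"
    then obtain u where u: "A = word_class R u"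
      by (auto simp: presented_group_def)
    let ?B = "word_class R (rev (map (\<lambda>(g, b). (g, \<not> b)) u))"
    have "?B \<otimes>\<^bsub>presented_group R\<^esub> A = word_class R []"
      unfolding u presented_group_mult word_class_eq_iff by (rule pres_eq_left_inverse)
    moreover have "?B \<in> carrier (presented_group R)"
      by (simp add: presented_group_def)
    ultimately show "\<exists>B\<in>carrier (presented_group R). B \<otimes>\<^bsub>presented_group R\<^esub> A = \<one>\<^bsub>presented_group R\<^esub>"
      unfolding one by blast
    show "\<one>\<^bsub>presented_group R\<^esub> \<otimes>\<^bsub>presented_group R\<^esub> A = A"
      unfolding u one presented_group_mult by simp
  next
    fix A B assume "A \<in> carrier (presented_group R)" "B \<in> carrier (presented_group R)"
    then obtain u v where "A = word_class R u" "B = word_class R v"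
      by (auto simp: presented_group_def)
    then have "A \<otimes>\<^bsub>presented_group R\<^esub> B = word_class R (u @ v)"
      by (simp add: presented_group_mult)
    then show "A \<otimes>\<^bsub>presented_group R\<^esub> B \<in> carrier (presented_group R)"
      by (simp add: presented_group_def)
  next
    fix A B C
    assume "A \<in> carrier (presented_group R)" "B \<in> carrier (presented_group R)"
      "C \<in> carrier (presented_group R)"
    then obtain u v w where "A = word_class R u" "B = word_class R v" "C = word_class R w"
      by (auto simp: presented_group_def)
    then show "A \<otimes>\<^bsub>presented_group R\<^esub> B \<otimes>\<^bsub>presented_group R\<^esub> C
        = A \<otimes>\<^bsub>presented_group R\<^esub> (B \<otimes>\<^bsub>presented_group R\<^esub> C)"
      by (simp add: presented_group_mult)
  next
    show "\<one>\<^bsub>presented_group R\<^esub> \<in> carrier (presented_group R)"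
      by (simp add: presented_group_def)
  qed
qed

context group
begin

lemma word_eval_closed:
  assumes "range f \<subseteq> carrier G"
  shows "word_eval G f u \<in> carrier G"
proof (induction u)
  case (Cons a u)
  then show ?case using assms by (cases a) auto
qed simp

lemma word_eval_append:
  assumes "range f \<subseteq> carrier G"
  shows "word_eval G f (u @ v) = word_eval G f u \<otimes> word_eval G f v"
proof (induction u)
  case Nil
  then show ?case using word_eval_closed[OF assms] by simp
next
  case (Cons a u)
  have "f g \<in> carrier G" for g using assms by auto
  then show ?case
    using Cons word_eval_closed[OF assms] by (cases a) (simp add: m_assoc)
qed

lemma word_eval_pres_eq:
  assumes "range f \<subseteq> carrier G"
    and "\<And>u v. (u, v) \<in> R \<Longrightarrow> word_eval G f u = word_eval G f v"
    and "pres_eq R u v"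
  shows "word_eval G f u = word_eval G f v"
  using assms(3)
proof induction
  case (cancel g b)
  have "f g \<in> carrier G" using assms(1) by auto
  then show ?case by simp
next
  case (relation u v)
  then show ?case by (rule assms(2))
next
  case (append u u' v v')
  then show ?case by (simp only: word_eval_append[OF assms(1)])
next
  case (trans u v w)
  from trans.IH show ?case by (rule HOL.trans)
next
  case (sym u v)
  from sym.IH show ?case by (rule HOL.sym[of "word_eval G f u"])
next
  case (refl u)
  show ?case ..
qed

lemma presented_hom_class:
  assumes "range f \<subseteq> carrier G"
    and "\<And>u v. (u, v) \<in> R \<Longrightarrow> word_eval G f u = word_eval G f v"
  shows "presented_hom G f (word_class R u) = word_eval G f u"
proof -
  have "word_eval G f v = word_eval G f u" if "v \<in> word_class R u" for v
    using word_eval_pres_eq[OF assms, where u = u and v = v] that by (simp add: word_class_def)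
  moreover have "u \<in> word_class R u"
    unfolding word_class_def by (simp add: pres_eq.refl)
  ultimately show ?thesis
    unfolding presented_hom_def by (intro the_elem_image_unique) blast+
qed

lemma presented_hom_hom:
  assumes "range f \<subseteq> carrier G"
    and "\<And>u v. (u, v) \<in> R \<Longrightarrow> word_eval G f u = word_eval G f v"
  shows "presented_hom G f \<in> hom (presented_group R) G"
proof (rule homI)
  fix A assume "A \<in> carrier (presented_group R)"
  then obtain u where "A = word_class R u" by (auto simp: presented_group_def)
  then show "presented_hom G f A \<in> carrier G"
    using presented_hom_class[OF assms] word_eval_closed[OF assms(1)] by simp
next
  fix A B assume "A \<in> carrier (presented_group R)" "B \<in> carrier (presented_group R)"
  then obtain u v where "A = word_class R u" "B = word_class R v"
    by (auto simp: presented_group_def)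
  then show "presented_hom G f (A \<otimes>\<^bsub>presented_group R\<^esub> B)
      = presented_hom G f A \<otimes> presented_hom G f B"
    using presented_hom_class[OF assms] word_eval_append[OF assms(1)]
    by (simp add: presented_group_mult)
qed

end

section \<open>The figure-eight knot group\<close>

datatype fig8_gen = Gen_x | Gen_y

abbreviation (input) letter :: "'g \<Rightarrow> 'g word" where "letter g \<equiv> [(g, True)]"
abbreviation (input) letter_inv :: "'g \<Rightarrow> 'g word" where "letter_inv g \<equiv> [(g, False)]"

definition fig8_w :: "fig8_gen word" where
  "fig8_w = letter_inv Gen_x @ letter Gen_y @ letter Gen_x @ letter_inv Gen_y"

definition fig8_rels :: "(fig8_gen word \<times> fig8_gen word) set" where
  "fig8_rels = {(fig8_w @ letter Gen_x, letter Gen_y @ fig8_w)}"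

definition fig8_group :: "fig8_gen word set monoid" where
  "fig8_group = presented_group fig8_rels"

section \<open>The representations\<close>

definition SL :: "(real^'n^'n) monoid" where
  "SL = \<lparr>carrier = {A. det A = 1}, monoid.mult = (**), one = mat 1\<rparr>"

definition phi_x :: "real \<Rightarrow> real^4^4" where
  "phi_x t = vector [vector [1, 0, 1, t - 1],
                     vector [0, 1, 1, t],
                     vector [0, 0, 1, t + 1/2],
                     vector [0, 0, 0, 1]]"

definition phi_y :: "real \<Rightarrow> real^4^4" where
  "phi_y t = vector [vector [1, 0, 0, 0],
                     vector [2 + 1/t, 1, 0, 0],
                     vector [2, 1, 1, 0],
                     vector [1, 1, 0, 1]]"

definition phi :: "real \<Rightarrow> fig8_gen word set \<Rightarrow> real^4^4" where
  "phi t = presented_hom SL (case_fig8_gen (phi_x t) (phi_y t))"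

lemma group_SL: "group (SL :: (real^'n^'n) monoid)"
proof (rule groupI)
  fix A :: "real^'n^'n" assume "A \<in> carrier SL"
  then have det: "det A = 1" by (simp add: SL_def)
  then have "invertible A" by (simp add: invertible_det_nz)
  then obtain B where inv: "B ** A = mat 1" by (auto simp: invertible_def)
  then have "det B * det A = 1" by (metis det_mul det_I)
  then show "\<exists>B\<in>carrier SL. B \<otimes>\<^bsub>SL\<^esub> A = \<one>\<^bsub>SL\<^esub>"
    using inv det by (auto simp: SL_def)
qed (auto simp: SL_def det_mul matrix_mul_assoc)

lemma vector_4 [simp]:
  "(vector [a, b, c, d] :: 'a::zero^4) $ 1 = a"
  "(vector [a, b, c, d] :: 'a::zero^4) $ 2 = b"
  "(vector [a, b, c, d] :: 'a::zero^4) $ 3 = c"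
  "(vector [a, b, c, d] :: 'a::zero^4) $ 4 = d"
  unfolding vector_def by simp_all

lemma
  shows phi_x_SL: "phi_x t \<in> carrier SL" and phi_y_SL: "phi_y t \<in> carrier SL"
proof -
  have f1: "finite {2::4, 3, 4}" "1 \<notin> {2::4, 3, 4}" by auto
  have f2: "finite {3::4, 4}" "2 \<notin> {3::4, 4}" by auto
  have f3: "finite {4::4}" "3 \<notin> {4::4}" by auto
  show "phi_x t \<in> carrier SL" "phi_y t \<in> carrier SL"
    unfolding SL_def det_def UNIV_4
    unfolding sum_over_permutations_insert[OF f1] sum_over_permutations_insert[OF f2]
      sum_over_permutations_insert[OF f3] permutes_sing
    by (simp_all add: sign_swap_id permutation_swap_id permutation_compose sign_compose sign_id
        swap_id_eq phi_x_def phi_y_def)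
qed

definition phi_x_inv :: "real \<Rightarrow> real^4^4" where
  "phi_x_inv t = vector [vector [1, 0, -1, 3/2],
                     vector [0, 1, -1, 1/2],
                     vector [0, 0, 1, - t - 1/2],
                     vector [0, 0, 0, 1]]"

definition phi_y_inv :: "real \<Rightarrow> real^4^4" where
  "phi_y_inv t = vector [vector [1, 0, 0, 0],
                     vector [- 2 - 1/t, 1, 0, 0],
                     vector [1/t, -1, 1, 0],
                     vector [1 + 1/t, -1, 0, 1]]"

lemma phi_x_mult_inv: "phi_x t ** phi_x_inv t = mat 1" "phi_x_inv t ** phi_x t = mat 1"
  by (simp_all add: vec_eq_iff forall_4 matrix_matrix_mult_def sum_4 mat_def phi_x_def phi_x_inv_def)
lemma phi_y_mult_inv: "phi_y t ** phi_y_inv t = mat 1" "phi_y_inv t ** phi_y t = mat 1"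
  by (simp_all add: vec_eq_iff forall_4 matrix_matrix_mult_def sum_4 mat_def phi_y_def phi_y_inv_def)

lemma phi_relation:
  assumes "t \<noteq> 0"
  shows "(phi_x_inv t ** phi_y t ** phi_x t ** phi_y_inv t) ** phi_x t
       = phi_y t ** (phi_x_inv t ** phi_y t ** phi_x t ** phi_y_inv t)"
  using assms
  by (simp add: vec_eq_iff forall_4 matrix_matrix_mult_def sum_4
        phi_x_def phi_y_def phi_x_inv_def phi_y_inv_def) (simp add: field_simps)

abbreviation fig8_x :: "fig8_gen word set" where
  "fig8_x \<equiv> word_class fig8_rels (letter Gen_x)"

abbreviation fig8_y :: "fig8_gen word set" where
  "fig8_y \<equiv> word_class fig8_rels (letter Gen_y)"

lemma group_fig8_group: "group fig8_group"
  unfolding fig8_group_def by (rule group_presented_group)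

lemma phi_hom:
  assumes "t \<noteq> 0"
  shows "phi t \<in> hom fig8_group SL"
    and "phi t fig8_x = phi_x t" and "phi t fig8_y = phi_y t"
proof -
  interpret SL: group "SL :: (real^4^4) monoid" by (rule group_SL)
  let ?f = "case_fig8_gen (phi_x t) (phi_y t)"
  have range: "range ?f \<subseteq> carrier SL"
    using phi_x_SL phi_y_SL by (auto split: fig8_gen.split)
  have "det (phi_x_inv t) = 1" "det (phi_y_inv t) = 1"
    using phi_x_SL[of t] phi_y_SL[of t] arg_cong[OF phi_x_mult_inv(1)[of t], of det]
      arg_cong[OF phi_y_mult_inv(1)[of t], of det]
    by (simp_all add: det_mul SL_def)
  then have inv: "inv\<^bsub>SL\<^esub> phi_x t = phi_x_inv t" "inv\<^bsub>SL\<^esub> phi_y t = phi_y_inv t"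
    using SL.inv_equality[of "phi_x_inv t" "phi_x t"] SL.inv_equality[of "phi_y_inv t" "phi_y t"]
      phi_x_mult_inv phi_y_mult_inv phi_x_SL phi_y_SL by (auto simp: SL_def)
  have rels: "word_eval SL ?f u = word_eval SL ?f v" if "(u, v) \<in> fig8_rels" for u v
    using that phi_relation[OF assms]
    by (simp add: fig8_rels_def fig8_w_def inv) (simp add: SL_def matrix_mul_assoc)
  show "phi t \<in> hom fig8_group SL"
    unfolding phi_def fig8_group_def by (rule SL.presented_hom_hom[OF range rels])
  show "phi t fig8_x = phi_x t"
    using SL.presented_hom_class[OF range rels, where u = "letter Gen_x"] phi_x_SL
    by (simp add: phi_def)
  show "phi t fig8_y = phi_y t"
    using SL.presented_hom_class[OF range rels, where u = "letter Gen_y"] phi_y_SL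
    by (simp add: phi_def)
qed

section \<open>The Zariski topology\<close>

text \<open>For \<open>a\<close> ranging over matrices, the real polynomial functions are the polynomials in the matrix
  entries.\<close>

definition zero_locus :: "('a::real_normed_vector \<Rightarrow> real) set \<Rightarrow> 'a set" where
  "zero_locus P = {a. \<forall>p\<in>P. p a = 0}"

definition zariski_topology :: "'a::euclidean_space topology" where
  "zariski_topology =
     topology (\<lambda>U. \<exists>P. (\<forall>p\<in>P. real_polynomial_function p) \<and> U = - zero_locus P)"

lemma istopology_zariski:
  "istopology (\<lambda>U :: 'a::euclidean_space set.
     \<exists>P. (\<forall>p\<in>P. real_polynomial_function p) \<and> U = - zero_locus P)"
  unfolding istopology_def
proof (intro conjI allI impI)
  fix S T :: "'a set"
  assume "\<exists>P. (\<forall>p\<in>P. real_polynomial_function p) \<and> S = - zero_locus P"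
    and "\<exists>P. (\<forall>p\<in>P. real_polynomial_function p) \<and> T = - zero_locus P"
  then obtain P Q where P: "\<forall>p\<in>P. real_polynomial_function p" "S = - zero_locus P"
    and Q: "\<forall>p\<in>Q. real_polynomial_function p" "T = - zero_locus Q"
    by blast
  let ?R = "{(\<lambda>a. p a * q a) | p q. p \<in> P \<and> q \<in> Q}"
  have "\<forall>p\<in>?R. real_polynomial_function p"
    using P Q by auto
  moreover have "S \<inter> T = - zero_locus ?R"
    using P(2) Q(2) by (auto simp: zero_locus_def; metis mult_eq_0_iff)
  ultimately show "\<exists>P. (\<forall>p\<in>P. real_polynomial_function p) \<and> S \<inter> T = - zero_locus P"
    by blast
next
  fix \<K> :: "'a set set"
  assume "\<forall>U\<in>\<K>. \<exists>P. (\<forall>p\<in>P. real_polynomial_function p) \<and> U = - zero_locus P"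
  then obtain P where P: "\<And>U. U \<in> \<K> \<Longrightarrow> (\<forall>p\<in>P U. real_polynomial_function p) \<and> U = - zero_locus (P U)"
    by metis
  have "\<Union>\<K> = - zero_locus (\<Union>U\<in>\<K>. P U)"
  proof -
    have "\<Union>\<K> = (\<Union>U\<in>\<K>. - zero_locus (P U))"
      using P by auto
    then show ?thesis by (auto simp: zero_locus_def)
  qed
  moreover have "\<forall>p\<in>(\<Union>U\<in>\<K>. P U). real_polynomial_function p"
    using P by blast
  ultimately show "\<exists>P. (\<forall>p\<in>P. real_polynomial_function p) \<and> \<Union>\<K> = - zero_locus P"
    by blast
qed

lemma openin_zariski_iff:
  "openin zariski_topology U \<longleftrightarrow>
     (\<exists>P. (\<forall>p\<in>P. real_polynomial_function p) \<and> U = - zero_locus P)"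
  unfolding zariski_topology_def topology_inverse'[OF istopology_zariski] ..

lemma topspace_zariski [simp]: "topspace zariski_topology = UNIV"
proof -
  have "real_polynomial_function (\<lambda>_. 1)" by (rule real_polynomial_function.intros)
  then have "openin zariski_topology UNIV"
    unfolding openin_zariski_iff by (intro exI[of _ "{\<lambda>_. 1}"]) (auto simp: zero_locus_def)
  then show ?thesis using openin_subset by blast
qed

lemma closedin_zariski_iff:
  "closedin zariski_topology Z \<longleftrightarrow>
     (\<exists>P. (\<forall>p\<in>P. real_polynomial_function p) \<and> Z = zero_locus P)"
  unfolding closedin_def openin_zariski_iff topspace_zariski
  by (auto simp: Compl_eq_Diff_UNIV[symmetric])

definition zariski_SL :: "(real^'n^'n) topology" where
  "zariski_SL = subtopology zariski_topology (carrier SL)"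

text \<open>In the next two definitions the qualified \<open>closure_of\<close> is needed because HOL-Algebra also
  declares infix syntax with that name.\<close>

definition zariski_dense :: "(real^'n^'n) set \<Rightarrow> bool" where
  "zariski_dense S \<longleftrightarrow> Abstract_Topology.closure_of zariski_SL S = topspace zariski_SL"

definition Gt :: "real \<Rightarrow> (real^4^4) set" where
  "Gt t = Abstract_Topology.closure_of zariski_SL (phi t ` carrier fig8_group)"

end

theory Submission
  imports Defs
begin

text \<open>The matrices \<open>A\<close> whose left-invariant derivation preserves the ideal of polynomials vanishing
  on \<open>\<Gamma>\<close>, the image of \<open>phi t\<close>, form a Lie algebra \<open>L\<close>.  As \<open>phi_x t\<close> and \<open>phi_y t\<close> are unipotent,
  \<open>L\<close> contains their logarithms \<open>N\<close> and \<open>M\<close>.  These have \<open>N\<^sup>3 = M\<^sup>3 = 0\<close>, with \<open>N\<^sup>2\<close> and \<open>M\<^sup>2\<close> of rank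
  one, so \<open>ad(N)\<^sup>4 M = 6 N\<^sup>2 M N\<^sup>2\<close> is a multiple of \<open>N\<^sup>2\<close>, and the multiple is nonzero exactly because
  \<open>t \<noteq> 1/2\<close>; likewise for \<open>M\<^sup>2\<close>.  In a basis where \<open>N\<^sup>2\<close> and \<open>M\<^sup>2\<close> are multiples of the matrix units
  \<open>E12\<close> and \<open>E21\<close>, a few further brackets give all off-diagonal matrix units; this
  uses only that \<open>t\<close>, \<open>2 t + 1\<close> and \<open>4 t\<^sup>2 + 2 t + 1\<close> are nonzero.  Hence every polynomial vanishing on \<open>\<Gamma>\<close> has all its
  derivatives along transvections vanishing on \<open>\<Gamma>\<close>, so it vanishes on the group generated by the
  transvections, which is \<open>SL(4)\<close>.\<close>

section \<open>Matrix multiplication as a bilinear map, and matrix units\<close>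

interpretation matrix_mult: bounded_bilinear "(**) :: real^'n^'m \<Rightarrow> real^'p^'n \<Rightarrow> real^'p^'m"
proof -
  have "bilinear ((**) :: real^'n^'m \<Rightarrow> real^'p^'n \<Rightarrow> real^'p^'m)"
    unfolding bilinear_def
    by (intro conjI allI linearI)
      (auto simp: matrix_matrix_mult_def vec_eq_iff sum.distrib sum_distrib_left algebra_simps)
  then show "bounded_bilinear ((**) :: real^'n^'m \<Rightarrow> real^'p^'n \<Rightarrow> real^'p^'m)"
    by (simp add: bilinear_conv_bounded_bilinear)
qed

lemmas matrix_algebra_simps =
  matrix_mult.add_left matrix_mult.add_right matrix_mult.diff_left matrix_mult.diff_right
  matrix_mult.scaleR_left matrix_mult.scaleR_right matrix_mult.minus_left matrix_mult.minus_right
  matrix_mult.zero_left matrix_mult.zero_right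

definition matrix_unit :: "'n \<Rightarrow> 'n \<Rightarrow> real^'n^'n" where
  "matrix_unit i j = (\<chi> k l. if k = i \<and> l = j then 1 else 0)"

lemma matrix_unit_mult:
  "matrix_unit i j ** matrix_unit k l = (if j = k then matrix_unit i l else 0)"
proof -
  have "(\<Sum>m\<in>UNIV. (if a = i \<and> m = j then 1 else 0) * (if m = k \<and> b = l then 1 else (0::real)))
      = (if j = k \<and> a = i \<and> b = l then 1 else 0)" for a b
  proof -
    have "(\<Sum>m\<in>UNIV. (if a = i \<and> m = j then 1 else 0) * (if m = k \<and> b = l then 1 else (0::real)))
        = (\<Sum>m\<in>UNIV. if m = j then (if j = k \<and> a = i \<and> b = l then 1 else 0) else 0)"
      by (rule sum.cong) auto
    then show ?thesis by simp
  qed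
  then show ?thesis
    by (simp add: vec_eq_iff matrix_unit_def matrix_matrix_mult_def)
qed

section \<open>Left-invariant derivations of polynomial functions\<close>

text \<open>The left-invariant vector field with value \<open>A\<close> at the identity, applied to
  \<open>f\<close>; its integral curve through \<open>g\<close> is \<open>g\<close> times the
  exponential of \<open>s A\<close>.\<close>

definition lie_deriv :: "real^'n^'n \<Rightarrow> (real^'n^'n \<Rightarrow> real) \<Rightarrow> real^'n^'n \<Rightarrow> real" where
  "lie_deriv A f g = frechet_derivative f (at g) (g ** A)"

lemma has_derivative_real_polynomial_function:
  "real_polynomial_function f \<Longrightarrow> (f has_derivative frechet_derivative f (at x)) (at x)"
  by (simp add: differentiable_at_real_polynomial_function flip: frechet_derivative_works)

lemma lie_deriv_linear: "bounded_linear f \<Longrightarrow> lie_deriv A f = (\<lambda>g. f (g ** A))"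
  by (simp add: lie_deriv_def fun_eq_iff
      flip: frechet_derivative_at[OF bounded_linear_imp_has_derivative])

lemma lie_deriv_const [simp]: "lie_deriv A (\<lambda>_. c) = (\<lambda>_. 0)"
  by (simp add: lie_deriv_def fun_eq_iff)

lemma lie_deriv_add:
  assumes "real_polynomial_function f" "real_polynomial_function h"
  shows "lie_deriv A (\<lambda>x. f x + h x) = (\<lambda>x. lie_deriv A f x + lie_deriv A h x)"
proof
  fix g
  have "((\<lambda>x. f x + h x) has_derivative
      (\<lambda>x. frechet_derivative f (at g) x + frechet_derivative h (at g) x)) (at g)"
    using assms by (intro has_derivative_add has_derivative_real_polynomial_function)
  from frechet_derivative_at[OF this, symmetric]
  show "lie_deriv A (\<lambda>x. f x + h x) g = lie_deriv A f g + lie_deriv A h g"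
    by (simp only: lie_deriv_def)
qed

lemma lie_deriv_mult:
  assumes "real_polynomial_function f" "real_polynomial_function h"
  shows "lie_deriv A (\<lambda>x. f x * h x) = (\<lambda>x. f x * lie_deriv A h x + lie_deriv A f x * h x)"
proof
  fix g
  have "((\<lambda>x. f x * h x) has_derivative
      (\<lambda>x. f g * frechet_derivative h (at g) x + frechet_derivative f (at g) x * h g)) (at g)"
    using assms by (intro has_derivative_mult has_derivative_real_polynomial_function)
  from frechet_derivative_at[OF this, symmetric]
  show "lie_deriv A (\<lambda>x. f x * h x) g = f g * lie_deriv A h g + lie_deriv A f g * h g"
    by (simp only: lie_deriv_def)
qed

lemma real_polynomial_function_lie_deriv:
  "real_polynomial_function f \<Longrightarrow> real_polynomial_function (lie_deriv A f)"
proof (induction rule: real_polynomial_function.induct)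
  case (linear f)
  then have "bounded_linear (\<lambda>g. f (g ** A))"
    by (rule bounded_linear_compose[OF _ matrix_mult.bounded_linear_left])
  then show ?case
    unfolding lie_deriv_linear[OF linear] by (rule real_polynomial_function.intros(1))
next
  case (const c)
  then show ?case by (simp add: real_polynomial_function.intros)
next
  case (add f g)
  then show ?case by (simp add: lie_deriv_add real_polynomial_function.intros)
next
  case (mult f g)
  then show ?case
    by (simp add: lie_deriv_mult real_polynomial_function.intros)
qed

lemma lie_deriv_add_matrix:
  assumes "real_polynomial_function f"
  shows "lie_deriv (A + B) f g = lie_deriv A f g + lie_deriv B f g"
  unfolding lie_deriv_def matrix_mult.add_right
  by (simp add: linear_add[OF linear_frechet_derivative[OF differentiable_at_real_polynomial_function[OF assms]]])

lemma lie_deriv_scaleR_matrix: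
  assumes "real_polynomial_function f"
  shows "lie_deriv (c *\<^sub>R A) f g = c * lie_deriv A f g"
  unfolding lie_deriv_def matrix_mult.scaleR_right
  by (simp add: linear_scale[OF linear_frechet_derivative[OF differentiable_at_real_polynomial_function[OF assms]]])

text \<open>Both sides obey the Leibniz rule in \<open>f\<close>, the mixed first-order terms
  cancelling on the right, so linear \<open>f\<close> decide; there the iterated derivatives are
  \<open>f (g ** C ** D)\<close>.\<close>

lemma lie_deriv_commutator:
  fixes f :: "real^'n^'n \<Rightarrow> real"
  shows "real_polynomial_function f \<Longrightarrow>
    lie_deriv (A ** B - B ** A) f g = lie_deriv A (lie_deriv B f) g - lie_deriv B (lie_deriv A f) g"
proof (induction arbitrary: g rule: real_polynomial_function.induct)
  case (linear f)
  have "bounded_linear (\<lambda>g. f (g ** C))" for C :: "real^'n^'n"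
    using linear by (rule bounded_linear_compose[OF _ matrix_mult.bounded_linear_left])
  from lie_deriv_linear[OF this]
  have "lie_deriv C (lie_deriv D f) g = f (g ** C ** D)" for C D :: "real^'n^'n"
    unfolding lie_deriv_linear[OF linear] by (rule fun_cong)
  then show ?case
    by (simp add: lie_deriv_linear[OF linear] matrix_mult.diff_right matrix_mul_assoc
        linear_diff[OF bounded_linear.linear[OF linear]])
next
  case (const c)
  then show ?case by simp
next
  case (add f h)
  then show ?case
    by (simp add: lie_deriv_add real_polynomial_function_lie_deriv)
next
  case (mult f h)
  show ?case
    by (simp add: lie_deriv_mult lie_deriv_add real_polynomial_function_lie_deriv
        real_polynomial_function.intros mult.hyps mult.IH) (simp add: algebra_simps)
qed

lemma lie_deriv_along_curve:
  assumes "real_polynomial_function f" and "(\<gamma> has_vector_derivative \<gamma> s ** A) (at s)"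
  shows "((\<lambda>s. f (\<gamma> s)) has_real_derivative lie_deriv A f (\<gamma> s)) (at s)"
proof -
  let ?f' = "frechet_derivative f (at (\<gamma> s))"
  have f': "(f has_derivative ?f') (at (\<gamma> s))"
    by (rule has_derivative_real_polynomial_function[OF assms(1)])
  then have "linear ?f'"
    by (rule has_derivative_linear)
  moreover have "((\<lambda>s. f (\<gamma> s)) has_derivative (\<lambda>h. ?f' (h *\<^sub>R (\<gamma> s ** A)))) (at s)"
    using has_derivative_compose[OF assms(2)[unfolded has_vector_derivative_def] f'] .
  ultimately show ?thesis
    by (simp add: has_field_derivative_def lie_deriv_def linear_scale mult_commute_abs)
qed

section \<open>The Lie algebra of a set of matrices\<close>

definition vanishing_polys :: "(real^'n^'n) set \<Rightarrow> (real^'n^'n \<Rightarrow> real) set" where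
  "vanishing_polys S = {f. real_polynomial_function f \<and> (\<forall>g\<in>S. f g = 0)}"

text \<open>For a group \<open>S\<close> of invertible matrices this is the Lie algebra of its
  Zariski closure; phrased through the ideal, it is closed under commutators for every
  \<open>S\<close>.\<close>

definition zariski_lie :: "(real^'n^'n) set \<Rightarrow> (real^'n^'n) set" where
  "zariski_lie S = {A. \<forall>f\<in>vanishing_polys S. lie_deriv A f \<in> vanishing_polys S}"

lemma zariski_lieI:
  assumes "\<And>f g. f \<in> vanishing_polys S \<Longrightarrow> g \<in> S \<Longrightarrow> lie_deriv A f g = 0"
  shows "A \<in> zariski_lie S"
proof -
  have "lie_deriv A f \<in> vanishing_polys S" if "f \<in> vanishing_polys S" for f
    using assms[OF that] that real_polynomial_function_lie_deriv[of f A]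
    by (simp add: vanishing_polys_def)
  then show ?thesis by (simp add: zariski_lie_def)
qed

lemma zariski_lieD:
  "A \<in> zariski_lie S \<Longrightarrow> f \<in> vanishing_polys S \<Longrightarrow> lie_deriv A f \<in> vanishing_polys S"
  by (simp add: zariski_lie_def)

lemma vanishing_polysD:
  assumes "f \<in> vanishing_polys S"
  shows "real_polynomial_function f" "g \<in> S \<Longrightarrow> f g = 0"
  using assms by (simp_all add: vanishing_polys_def)

lemma zariski_lie_add:
  assumes "A \<in> zariski_lie S" "B \<in> zariski_lie S"
  shows "A + B \<in> zariski_lie S"
proof (rule zariski_lieI)
  fix f g assume f: "f \<in> vanishing_polys S" and g: "g \<in> S"
  show "lie_deriv (A + B) f g = 0"
    using assms[THEN zariski_lieD, OF f, THEN vanishing_polysD(2), OF g]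
    by (simp add: lie_deriv_add_matrix[OF vanishing_polysD(1)[OF f]])
qed

lemma zariski_lie_scaleR:
  assumes "A \<in> zariski_lie S"
  shows "c *\<^sub>R A \<in> zariski_lie S"
proof (rule zariski_lieI)
  fix f g assume f: "f \<in> vanishing_polys S" and g: "g \<in> S"
  show "lie_deriv (c *\<^sub>R A) f g = 0"
    using vanishing_polysD(2)[OF zariski_lieD[OF assms f] g]
    by (simp add: lie_deriv_scaleR_matrix[OF vanishing_polysD(1)[OF f]])
qed

lemma zariski_lie_commutator:
  assumes "A \<in> zariski_lie S" "B \<in> zariski_lie S"
  shows "A ** B - B ** A \<in> zariski_lie S"
proof (rule zariski_lieI)
  fix f g assume f: "f \<in> vanishing_polys S" and g: "g \<in> S"
  have "lie_deriv A (lie_deriv B f) \<in> vanishing_polys S"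
    "lie_deriv B (lie_deriv A f) \<in> vanishing_polys S"
    using assms f by (blast intro: zariski_lieD)+
  then show "lie_deriv (A ** B - B ** A) f g = 0"
    by (simp add: lie_deriv_commutator[OF vanishing_polysD(1)[OF f]] vanishing_polysD(2)[OF _ g])
qed

lemma real_polynomial_function_eq_0_of_nat:
  fixes h :: "real \<Rightarrow> real"
  assumes "real_polynomial_function h" and "\<And>n. h (real n) = 0"
  shows "h x = 0"
proof -
  obtain a n where h: "h = (\<lambda>x. \<Sum>i\<le>n. a i * x ^ i)"
    using assms(1) by (auto simp: real_polynomial_function_iff_sum)
  have "infinite (range real)"
    by (simp add: range_inj_infinite inj_on_def)
  then have "\<not> finite {z. (\<Sum>i\<le>n. a i * z ^ i) = 0}"
    using assms(2) h by (metis (mono_tags, lifting) finite_subset image_subsetI mem_Collect_eq)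
  then have "\<forall>i\<le>n. a i = 0"
    by (simp add: polyfun_finite_roots)
  then show ?thesis
    by (simp add: h)
qed

text \<open>A polynomial vanishing on the powers of a unipotent matrix vanishes on the whole
  one-parameter group through them; its logarithm is therefore in the Lie algebra.\<close>

lemma zariski_lie_unipotent:
  fixes N :: "real^'n^'n"
  assumes nil: "N ** N ** N = 0"
    and S: "\<And>g. g \<in> S \<Longrightarrow> g ** (mat 1 + N + (1/2) *\<^sub>R (N ** N)) \<in> S"
  shows "N \<in> zariski_lie S"
proof (rule zariski_lieI)
  fix f g assume f: "f \<in> vanishing_polys S" and g: "g \<in> S"
  \<comment> \<open>The curve \<open>g\<close> times the exponential of \<open>s N\<close>, the
    series ending because \<open>N ** N ** N = 0\<close>. At natural numbers it stays in
    \<open>S\<close> by assumption.\<close>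
  define \<gamma> where "\<gamma> s = g + s *\<^sub>R (g ** N) + (s\<^sup>2 / 2) *\<^sub>R (g ** N ** N)" for s
  have pf: "real_polynomial_function f"
    using f by (simp add: vanishing_polys_def)
  have nil': "h ** N ** N ** N = 0" for h :: "real^'n^'n"
    by (metis nil matrix_mul_assoc matrix_mult.zero_right)
  have "\<gamma> (real n) \<in> S" for n
  proof (induction n)
    case (Suc n)
    have "\<gamma> (real (Suc n)) = \<gamma> (real n) ** (mat 1 + N + (1/2) *\<^sub>R (N ** N))"
      by (simp add: \<gamma>_def matrix_algebra_simps matrix_mul_assoc nil' power2_eq_square
          algebra_simps add_divide_distrib)
    then show ?case using S[OF Suc.IH] by simp
  qed (simp add: \<gamma>_def g)
  moreover have "polynomial_function \<gamma>"
    unfolding \<gamma>_def power2_eq_square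
    by (intro polynomial_function_add polynomial_function_const polynomial_function_mult
        real_polynomial_function_divide[unfolded real_polynomial_function_eq])
      (auto simp: real_polynomial_function.intros simp flip: real_polynomial_function_eq)
  then have "real_polynomial_function (\<lambda>s. f (\<gamma> s))"
    using real_polynomial_function_compose[OF _ pf] by (simp add: o_def)
  ultimately have "f (\<gamma> s) = 0" for s
    using real_polynomial_function_eq_0_of_nat[of "\<lambda>s. f (\<gamma> s)"] f
    by (simp add: vanishing_polys_def)
  moreover have "(\<gamma> has_vector_derivative \<gamma> 0 ** N) (at 0)"
    unfolding \<gamma>_def by (auto intro!: derivative_eq_intros simp: matrix_algebra_simps)
  then have "((\<lambda>s. f (\<gamma> s)) has_real_derivative lie_deriv N f g) (at 0)"
    using lie_deriv_along_curve[OF pf, of \<gamma> 0 N] by (simp add: \<gamma>_def)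
  ultimately show "lie_deriv N f g = 0"
    using DERIV_unique[of "\<lambda>_. 0" _ 0 0] by simp
qed

text \<open>As \<open>N ** N = 0\<close>, the factor is the exponential of \<open>s N\<close>. Along
  this curve \<open>f\<close> is a polynomial in \<open>s\<close>, and its derivative is
  \<open>lie_deriv N f\<close> along the curve, again an element of the ideal.\<close>

lemma vanishing_polys_exp:
  assumes "N \<in> zariski_lie S" and nil: "N ** N = 0"
    and "f \<in> vanishing_polys S" and "g \<in> S"
  shows "f (g ** (mat 1 + s *\<^sub>R N)) = 0"
proof -
  define \<gamma> where "\<gamma> s = g ** (mat 1 + s *\<^sub>R N)" for s
  have \<gamma>: "(\<gamma> has_vector_derivative \<gamma> s ** N) (at s)" for s
    unfolding \<gamma>_def
    by (auto intro!: derivative_eq_intros simp: matrix_algebra_simps nil simp flip: matrix_mul_assoc)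
  have "polynomial_function \<gamma>"
    unfolding \<gamma>_def matrix_algebra_simps
    by (intro polynomial_function_add polynomial_function_const polynomial_function_mult
        polynomial_function_id)
  from real_polynomial_function_compose[OF this]
  have pol: "\<And>f. f \<in> vanishing_polys S \<Longrightarrow> real_polynomial_function (\<lambda>s. f (\<gamma> s))"
    by (simp add: o_def vanishing_polys_def)
  have ex: "\<exists>p. \<forall>s. f (\<gamma> s) = poly p s" if f: "f \<in> vanishing_polys S" for f
  proof -
    obtain a n where "(\<lambda>s. f (\<gamma> s)) = (\<lambda>s. \<Sum>i\<le>n. a i * s ^ i)"
      using pol[OF f] unfolding real_polynomial_function_iff_sum by blast
    then have "f (\<gamma> s) = poly (\<Sum>i\<le>n. monom (a i) i) s" for s
      by (simp add: fun_eq_iff poly_sum poly_monom)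
    then show ?thesis by (intro exI allI)
  qed
  \<comment> \<open>The induction generalises over \<open>f\<close>, since differentiating in
    \<open>s\<close> lowers the degree of \<open>p\<close> and replaces \<open>f\<close> by
    \<open>lie_deriv N f\<close>.\<close>
  have "p = 0" if "f \<in> vanishing_polys S" "\<forall>s. f (\<gamma> s) = poly p s" for p f
    using that
  proof (induction "degree p" arbitrary: p f rule: less_induct)
    case less
    have "f (\<gamma> 0) = 0"
      using vanishing_polysD(2)[OF less.prems(1) \<open>g \<in> S\<close>] by (simp add: \<gamma>_def)
    then have p0: "poly p 0 = 0"
      using less.prems(2) by simp
    have f': "lie_deriv N f \<in> vanishing_polys S"
      using assms(1) less.prems(1) by (simp add: zariski_lie_def)
    have "((\<lambda>s. f (\<gamma> s)) has_real_derivative lie_deriv N f (\<gamma> s)) (at s)" for s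
      using less.prems(1) by (intro lie_deriv_along_curve \<gamma>) (simp add: vanishing_polys_def)
    then have d: "\<forall>s. lie_deriv N f (\<gamma> s) = poly (pderiv p) s"
      using less.prems(2) by (intro allI DERIV_unique[OF _ poly_DERIV]) simp
    have "pderiv p = 0"
    proof (cases "degree p = 0")
      case False
      then show ?thesis
        using less.hyps[OF _ f' d] by (simp add: degree_pderiv)
    qed (simp add: pderiv_eq_0_iff)
    then obtain c where "p = [:c:]"
      by (metis degree_eq_zeroE pderiv_eq_0_iff)
    with p0 show "p = 0" by simp
  qed
  moreover obtain p where "\<forall>s. f (\<gamma> s) = poly p s"
    using ex[OF assms(3)] by blast
  ultimately have "f (\<gamma> s) = 0"
    using assms(3) by (metis poly_0)
  then show ?thesis
    by (simp add: \<gamma>_def)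
qed

section \<open>Transvections generate the special linear group\<close>

lemma matrix_unit_mult_left:
  "matrix_unit i j ** A = (\<chi> k. if k = i then row j A else 0)"
proof -
  have "(\<Sum>m\<in>UNIV. (if k = i \<and> m = j then 1 else 0) * A $ m $ l) = (if k = i then A $ j $ l else 0)"
    for k l
  proof -
    have "(\<Sum>m\<in>UNIV. (if k = i \<and> m = j then 1 else 0) * A $ m $ l)
        = (\<Sum>m\<in>UNIV. if m = j then (if k = i then A $ j $ l else 0) else 0)"
      by (rule sum.cong) auto
    then show ?thesis by simp
  qed
  then show ?thesis
    by (simp add: vec_eq_iff matrix_unit_def matrix_matrix_mult_def row_def)
qed

lemma matrix_unit_mult_right:
  "A ** matrix_unit i j = (\<chi> k l. if l = j then A $ k $ i else 0)"
proof -
  have "(\<Sum>m\<in>UNIV. A $ k $ m * (if m = i \<and> l = j then 1 else 0)) = (if l = j then A $ k $ i else 0)"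
    for k l
  proof -
    have "(\<Sum>m\<in>UNIV. A $ k $ m * (if m = i \<and> l = j then 1 else 0))
        = (\<Sum>m\<in>UNIV. if m = i then (if l = j then A $ k $ i else 0) else 0)"
      by (rule sum.cong) auto
    then show ?thesis by simp
  qed
  then show ?thesis
    by (simp add: vec_eq_iff matrix_unit_def matrix_matrix_mult_def)
qed

definition transvection :: "'n \<Rightarrow> 'n \<Rightarrow> real \<Rightarrow> real^'n^'n" where
  "transvection i j c = mat 1 + c *\<^sub>R matrix_unit i j"

lemma transvection_mult_left:
  "transvection i j c ** A = (\<chi> k. if k = i then row i A + c *\<^sub>R row j A else row k A)"
  by (simp add: transvection_def matrix_algebra_simps matrix_unit_mult_left vec_eq_iff row_def)

lemma det_transvection_mult:
  "i \<noteq> j \<Longrightarrow> det (transvection i j c ** A) = det A"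
  unfolding transvection_mult_left
  using det_row_operation[where i = i and j = j and c = c and A = A]
  unfolding scalar_mult_eq_scaleR by simp

text \<open>This monoid is a group, since \<open>transvection i j (- c)\<close> inverts
  \<open>transvection i j c\<close> for \<open>i \<noteq> j\<close>.\<close>

inductive_set transvection_group :: "(real^'n^'n) set" where
  one: "mat 1 \<in> transvection_group"
| mult: "i \<noteq> j \<Longrightarrow> A \<in> transvection_group \<Longrightarrow> transvection i j c ** A \<in> transvection_group"

lemma transvection_in_group: "i \<noteq> j \<Longrightarrow> transvection i j c \<in> transvection_group"
  using transvection_group.mult[OF _ transvection_group.one] by fastforce

lemma transvection_group_mult:
  "A \<in> transvection_group \<Longrightarrow> B \<in> transvection_group \<Longrightarrow> A ** B \<in> transvection_group"
proof (induction rule: transvection_group.induct)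
  case (mult i j A c)
  then show ?case
    using transvection_group.mult[of i j "A ** B" c] by (simp add: matrix_mul_assoc)
qed simp

lemma det_transvection_group: "A \<in> transvection_group \<Longrightarrow> det A = 1"
  by (induction rule: transvection_group.induct) (simp_all add: det_transvection_mult)

text \<open>For \<open>i \<noteq> j\<close> and nonzero \<open>x\<close>, a determinant-one
  substitute for the transposition of \<open>i\<close> and \<open>j\<close>.\<close>

definition weyl_matrix :: "'n \<Rightarrow> 'n \<Rightarrow> real \<Rightarrow> real^'n^'n" where
  "weyl_matrix i j x =
     mat 1 - matrix_unit i i - matrix_unit j j + x *\<^sub>R matrix_unit i j - (1/x) *\<^sub>R matrix_unit j i"

lemma weyl_matrix_in_group:
  assumes "i \<noteq> j" "x \<noteq> 0"
  shows "weyl_matrix i j x \<in> transvection_group"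
proof -
  have "weyl_matrix i j x = transvection i j x ** (transvection j i (-1/x) ** transvection i j x)"
    using assms by (simp add: weyl_matrix_def transvection_def matrix_algebra_simps matrix_unit_mult algebra_simps)
  then show ?thesis
    using assms by (simp add: transvection_group_mult transvection_in_group)
qed

definition diag_matrix :: "('n \<Rightarrow> real) \<Rightarrow> real^'n^'n" where
  "diag_matrix d = (\<chi> i j. if i = j then d i else 0)"

lemma mult_diag_matrix: "A ** diag_matrix d = (\<chi> i j. A $ i $ j * d j)"
  by (simp add: diag_matrix_def matrix_matrix_mult_def vec_eq_iff if_distrib cong: if_cong)

lemma diag_matrix_mult: "diag_matrix d ** diag_matrix e = diag_matrix (\<lambda>i. d i * e i)"
  unfolding mult_diag_matrix by (simp add: diag_matrix_def vec_eq_iff)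

lemma det_diag_matrix: "det (diag_matrix d) = prod d UNIV"
  by (subst det_diagonal) (simp_all add: diag_matrix_def)

text \<open>In the plane of \<open>i\<close> and \<open>j\<close>, the Weyl matrices with parameters
  \<open>x\<close> and \<open>-1\<close> multiply to the diagonal block with entries
  \<open>x\<close> and \<open>1/x\<close>.\<close>

lemma diag_matrix_pair_in_group:
  assumes "i \<noteq> j" "x \<noteq> 0"
  shows "diag_matrix ((\<lambda>_. 1)(i := x, j := 1/x)) \<in> transvection_group"
proof -
  have "diag_matrix ((\<lambda>_. 1)(i := x, j := 1/x))
      = mat 1 + (x - 1) *\<^sub>R matrix_unit i i + (1/x - 1) *\<^sub>R matrix_unit j j"
    using assms by (auto simp: diag_matrix_def matrix_unit_def mat_def vec_eq_iff)
  also have "\<dots> = weyl_matrix i j x ** weyl_matrix i j (-1)"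
    using assms by (simp add: weyl_matrix_def matrix_algebra_simps matrix_unit_mult algebra_simps)
  finally show ?thesis
    using assms by (simp add: transvection_group_mult weyl_matrix_in_group)
qed

lemma diag_matrix_in_group:
  assumes "prod d UNIV = 1"
  shows "diag_matrix d \<in> transvection_group"
proof -
  fix k :: 'a
  have d0: "d i \<noteq> 0" for i
    using assms by (metis finite_UNIV finite_code UNIV_I prod_zero_iff zero_neq_one)
  \<comment> \<open>Entry \<open>k\<close> carries the reciprocal of the product over
    \<open>K\<close>, keeping determinant 1 while \<open>K\<close> grows to all other indices; at
    the end it equals \<open>d k\<close>.\<close>
  have *: "diag_matrix (\<lambda>i. if i \<in> K then d i else if i = k then 1 / prod d K else 1)
      \<in> transvection_group" if "finite K" "k \<notin> K" for K
    using that
  proof (induction rule: finite_induct)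
    case empty
    have "diag_matrix (\<lambda>i. if i \<in> {} then d i else if i = k then 1 / prod d {} else 1) = mat 1"
      by (simp add: diag_matrix_def mat_def vec_eq_iff)
    then show ?case using transvection_group.one by (rule ssubst)
  next
    case (insert i K)
    let ?d = "\<lambda>K i. if i \<in> K then d i else if i = k then 1 / prod d K else 1"
    have "diag_matrix (?d (insert i K)) = diag_matrix ((\<lambda>_. 1)(i := d i, k := 1 / d i)) ** diag_matrix (?d K)"
      using insert.hyps insert.prems unfolding diag_matrix_mult
      by (intro arg_cong[of _ _ diag_matrix]) (auto simp: fun_eq_iff)
    moreover have "i \<noteq> k"
      using insert.prems by auto
    ultimately show ?case
      using insert d0 by (simp add: transvection_group_mult diag_matrix_pair_in_group)
  qed
  have "prod d UNIV = d k * prod d (UNIV - {k})"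
    by (simp add: prod.remove)
  then have "1 / prod d (UNIV - {k}) = d k"
    using assms by (auto simp: d0 divide_eq_eq)
  then have "(\<lambda>i. if i \<in> UNIV - {k} then d i else if i = k then 1 / prod d (UNIV - {k}) else 1) = d"
    by auto
  then show ?thesis
    using *[of "UNIV - {k}"] by simp
qed

text \<open>A bare column swap has determinant -1; the sign goes into the diagonal factor, and a
  Weyl matrix remains.\<close>

lemma swap_cols_mult_diag_matrix:
  assumes "m \<noteq> n"
  shows "(\<chi> i j. A $ i $ Transposition.transpose m n j) ** diag_matrix d
      = A ** diag_matrix (d(m := d n, n := - d m)) ** weyl_matrix m n 1"
  using assms
  by (auto simp: weyl_matrix_def matrix_algebra_simps matrix_unit_mult_right mult_diag_matrix
      vec_eq_iff Transposition.transpose_def)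

lemma det_eq_1_imp_transvection_group:
  fixes A :: "real^'n^'n"
  assumes "det A = 1"
  shows "A \<in> transvection_group"
proof -
  \<comment> \<open>The diagonal factor is quantified because a column swap permutes its entries and
    changes a sign; \<open>d\<close> constantly 1 gives the claim.\<close>
  have "\<forall>d. det (A ** diag_matrix d) = 1 \<longrightarrow> A ** diag_matrix d \<in> transvection_group"
  proof (induction A rule: induct_matrix_row_operations)
    case (1 A i)
    then show ?case by (simp add: det_mul det_zero_row)
  next
    case (2 A)
    then have A: "A = diag_matrix (\<lambda>i. A $ i $ i)"
      by (simp add: diag_matrix_def vec_eq_iff)
    show ?case
      by (subst (1 2) A) (simp add: diag_matrix_mult det_diag_matrix diag_matrix_in_group)
  next
    case (3 A m n)
    show ?case
    proof (intro allI impI)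
      fix d
      let ?B = "A ** diag_matrix (d(m := d n, n := - d m))"
      assume *: "det ((\<chi> i j. A $ i $ Transposition.transpose m n j) ** diag_matrix d) = 1"
      have w: "weyl_matrix m n 1 \<in> transvection_group"
        using \<open>m \<noteq> n\<close> by (simp add: weyl_matrix_in_group)
      have "det (?B ** weyl_matrix m n 1) = 1"
        using * unfolding swap_cols_mult_diag_matrix[OF \<open>m \<noteq> n\<close>] .
      then have "det ?B = 1"
        by (simp add: det_mul[of ?B] det_transvection_group[OF w])
      then have "?B \<in> transvection_group"
        using 3(1) by blast
      then show "(\<chi> i j. A $ i $ Transposition.transpose m n j) ** diag_matrix d \<in> transvection_group"
        unfolding swap_cols_mult_diag_matrix[OF \<open>m \<noteq> n\<close>] using w by (rule transvection_group_mult)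
    qed
  next
    case (4 A m n c)
    show ?case
      unfolding transvection_mult_left[symmetric] matrix_mul_assoc[symmetric]
      using 4 by (simp add: det_transvection_mult transvection_group.mult)
  qed
  moreover have "diag_matrix (\<lambda>_. 1) = (mat 1 :: real^'n^'n)"
    by (simp add: diag_matrix_def mat_def)
  ultimately show ?thesis
    using assms by (auto dest: spec[where x = "\<lambda>_. 1"])
qed

lemma vanishing_polys_SL:
  fixes S :: "(real^'n^'n) set"
  assumes lie: "\<And>i j. i \<noteq> j \<Longrightarrow> matrix_unit i j \<in> zariski_lie S"
    and "mat 1 \<in> S" and f: "f \<in> vanishing_polys S" and "det A = 1"
  shows "f A = 0"
proof -
  \<comment> \<open>Claimed on all of \<open>S\<close>, so that the induction hypothesis puts the
    right translate of \<open>f\<close> by \<open>A\<close> into the ideal;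
    \<open>vanishing_polys_exp\<close> then absorbs the next transvection.\<close>
  have "\<forall>g\<in>S. f (g ** A) = 0"
    using det_eq_1_imp_transvection_group[OF \<open>det A = 1\<close>]
  proof (induction rule: transvection_group.induct)
    case one
    then show ?case using f by (simp add: vanishing_polys_def)
  next
    case (mult i j A c)
    have "polynomial_function (\<lambda>g :: real^'n^'n. g ** A)"
      by (intro polynomial_function_bounded_linear matrix_mult.bounded_linear_left)
    from real_polynomial_function_compose[OF this vanishing_polysD(1)[OF f]]
    have "(\<lambda>g. f (g ** A)) \<in> vanishing_polys S"
      using mult.IH by (simp add: vanishing_polys_def o_def)
    moreover have "matrix_unit i j ** matrix_unit i j = (0 :: real^'n^'n)"
      using mult.hyps by (simp add: matrix_unit_mult)
    ultimately show ?case
      using vanishing_polys_exp[OF lie[OF mult.hyps(1)], of "\<lambda>g. f (g ** A)" _ c]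
      by (simp add: transvection_def matrix_mul_assoc)
  qed
  then show ?thesis
    using \<open>mat 1 \<in> S\<close> by force
qed

section \<open>The Lie algebra generated by the two logarithms\<close>

text \<open>Binomial expansion of the fourth power of \<open>ad\<close>: every term but the middle
  one contains \<open>N ** N ** N\<close>, and 6 is the middle coefficient.\<close>

lemma ad_4_nilpotent:
  fixes N M :: "real^'n^'n"
  defines "ad \<equiv> \<lambda>B. N ** B - B ** N"
  assumes nil: "N ** N ** N = 0"
  shows "ad (ad (ad (ad M))) = 6 *\<^sub>R (N ** N ** M ** N ** N)"
proof -
  have nil': "B ** N ** N ** N = 0" for B :: "real^'n^'n"
    by (metis nil matrix_mul_assoc matrix_mult.zero_right)
  show ?thesis
    by (simp only: ad_def matrix_mult.diff_left matrix_mult.diff_right matrix_mul_assoc nil nil'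
        matrix_mult.zero_left) (simp add: vec_eq_iff)
qed

text \<open>The logarithms of \<open>phi_x t\<close> and \<open>phi_y t\<close>, written in the basis of the columns of
  \<open>adapted_basis\<close> below.  That basis is \<open>e1 + e2, e3 + e4, e2, e3\<close>: its first two vectors span the
  images of the squares of the two logarithms, which thereby become multiples of matrix units.\<close>

definition log_x :: "real \<Rightarrow> real^4^4" where
  "log_x t = ((t - 1/2) / 2) *\<^sub>R matrix_unit 1 2 + matrix_unit 1 4 + matrix_unit 3 2
     + (t + 1/2) *\<^sub>R matrix_unit 4 2"

definition log_y :: "real \<Rightarrow> real^4^4" where
  "log_y t = (1 - 1 / (2 * t)) *\<^sub>R matrix_unit 2 1 + matrix_unit 2 3 + (2 + 1/t) *\<^sub>R matrix_unit 3 1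
     + matrix_unit 4 1"

lemma log_x_square: "log_x t ** log_x t = (t + 1/2) *\<^sub>R matrix_unit 1 2"
  by (simp add: log_x_def matrix_algebra_simps matrix_unit_mult)

lemma log_y_square: "log_y t ** log_y t = (2 + 1/t) *\<^sub>R matrix_unit 2 1"
  by (simp add: log_y_def matrix_algebra_simps matrix_unit_mult)

lemma log_x_cube: "log_x t ** log_x t ** log_x t = 0"
  unfolding log_x_square by (simp add: log_x_def matrix_algebra_simps matrix_unit_mult)

lemma log_y_cube: "log_y t ** log_y t ** log_y t = 0"
  unfolding log_y_square by (simp add: log_y_def matrix_algebra_simps matrix_unit_mult)

lemma matrix_unit_in_generated_lie_algebra:
  fixes L :: "(real^4^4) set"
  assumes t: "t > 0" "t \<noteq> 1/2"
    and add: "\<And>A B. A \<in> L \<Longrightarrow> B \<in> L \<Longrightarrow> A + B \<in> L"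
    and scale: "\<And>c A. A \<in> L \<Longrightarrow> c *\<^sub>R A \<in> L"
    and commutator: "\<And>A B. A \<in> L \<Longrightarrow> B \<in> L \<Longrightarrow> A ** B - B ** A \<in> L"
    and x: "log_x t \<in> L" and y: "log_y t \<in> L"
    and "i \<noteq> j"
  shows "matrix_unit i j \<in> L"
proof -
  define c where "c = t + 1/2"
  define d where "d = 2 + 1/t"
  have c0: "c \<noteq> 0" and d0: "d \<noteq> 0"
    using t by (simp_all add: c_def d_def add_pos_pos pos_add_strict less_imp_neq[symmetric])
  \<comment> \<open>This is the determinant of the coordinates of \<open>w1\<close> and
    \<open>w2\<close> below with respect to \<open>E32\<close> and \<open>E42\<close>.\<close>
  have "1 - c * d = - (4 * t\<^sup>2 + 2 * t + 1) / (2 * t)"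
    using t by (simp add: c_def d_def field_simps power2_eq_square)
  moreover have "4 * t\<^sup>2 + 2 * t + 1 > 0"
    using t by (simp add: add_pos_pos)
  ultimately have cd: "1 - c * d \<noteq> 0"
    using t by simp
  have diff: "A - B \<in> L" if "A \<in> L" "B \<in> L" for A B
    using add[OF that(1) scale[OF that(2), of "-1"]] by simp
  have unscale: "A \<in> L" if "k *\<^sub>R A \<in> L" "k \<noteq> 0" for k A
    using scale[OF that(1), of "1/k"] that(2) by simp

  \<comment> \<open>Multiplying by \<open>matrix_unit 1 2\<close> on both sides extracts the (2,1)
    entry \<open>1 - 1 / (2 * t)\<close> of \<open>log_y t\<close>, which is zero only at
    \<open>t = 1/2\<close>. With the roles exchanged, the (1,2) entry of \<open>log_x t\<close>
    appears.\<close>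
  have "6 *\<^sub>R (log_x t ** log_x t ** log_y t ** log_x t ** log_x t) \<in> L"
    unfolding ad_4_nilpotent[OF log_x_cube, symmetric] using x y by (intro commutator)
  also have "6 *\<^sub>R (log_x t ** log_x t ** log_y t ** log_x t ** log_x t)
      = (6 * c\<^sup>2 * (1 - 1 / (2 * t))) *\<^sub>R matrix_unit 1 2"
    unfolding log_x_square matrix_mul_assoc[symmetric]
    by (simp add: log_y_def matrix_algebra_simps matrix_unit_mult c_def power2_eq_square)
  finally have E12: "matrix_unit 1 2 \<in> L"
    by (rule unscale) (use t c0 in \<open>simp add: field_simps\<close>)
  have "6 *\<^sub>R (log_y t ** log_y t ** log_x t ** log_y t ** log_y t) \<in> L"
    unfolding ad_4_nilpotent[OF log_y_cube, symmetric] using x y by (intro commutator)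
  also have "6 *\<^sub>R (log_y t ** log_y t ** log_x t ** log_y t ** log_y t)
      = (6 * d\<^sup>2 * ((t - 1/2) / 2)) *\<^sub>R matrix_unit 2 1"
    unfolding log_y_square matrix_mul_assoc[symmetric]
    by (simp add: log_x_def matrix_algebra_simps matrix_unit_mult d_def power2_eq_square)
  finally have E21: "matrix_unit 2 1 \<in> L"
    by (rule unscale) (use t d0 in \<open>simp add: field_simps\<close>)

  \<comment> \<open>With respect to the sl2 spanned by \<open>E12\<close>, \<open>E21\<close> and their bracket, what remains of
    \<open>log_x t\<close> is \<open>E14 + w1\<close>; the double bracket \<open>K\<close> below acts on its two summands with opposite
    eigenvalues \<open>-3 c\<close> and \<open>3 c\<close>, and so separates them.  The same happens with \<open>E13\<close> and \<open>w2\<close>.\<close>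
  define w1 w2 :: "real^4^4"
    where "w1 = matrix_unit 3 2 + c *\<^sub>R matrix_unit 4 2"
      and "w2 = d *\<^sub>R matrix_unit 3 2 + matrix_unit 4 2"
  have "log_x t - ((t - 1/2) / 2) *\<^sub>R matrix_unit 1 2 \<in> L"
    using x E12 by (intro diff scale)
  then have n: "matrix_unit 1 4 + w1 \<in> L"
    by (simp add: log_x_def c_def w1_def algebra_simps)
  have "matrix_unit 2 1 ** (matrix_unit 1 4 + w1) - (matrix_unit 1 4 + w1) ** matrix_unit 2 1 \<in> L"
    using n E21 by (intro commutator)
  then have n': "matrix_unit 2 4 - matrix_unit 3 1 - c *\<^sub>R matrix_unit 4 1 \<in> L" (is "?n' \<in> L")
    by (simp add: w1_def matrix_algebra_simps matrix_unit_mult algebra_simps)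
  have "(matrix_unit 1 4 + w1) ** ?n' - ?n' ** (matrix_unit 1 4 + w1) \<in> L"
    using n n' by (intro commutator)
  also have "(matrix_unit 1 4 + w1) ** ?n' - ?n' ** (matrix_unit 1 4 + w1)
      = 2 *\<^sub>R matrix_unit 3 4 + (2 * c) *\<^sub>R matrix_unit 4 4 - c *\<^sub>R matrix_unit 1 1 - c *\<^sub>R matrix_unit 2 2"
    (is "_ = ?K")
    by (simp add: w1_def matrix_algebra_simps matrix_unit_mult) (simp add: vec_eq_iff algebra_simps)
  finally have "?K ** (matrix_unit 1 4 + w1) - (matrix_unit 1 4 + w1) ** ?K \<in> L"
    using n by (intro commutator)
  also have "?K ** (matrix_unit 1 4 + w1) - (matrix_unit 1 4 + w1) ** ?K
      = (3 * c) *\<^sub>R (w1 - matrix_unit 1 4)"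
    by (simp add: w1_def matrix_algebra_simps matrix_unit_mult) (simp add: vec_eq_iff algebra_simps)
  finally have n'': "w1 - matrix_unit 1 4 \<in> L"
    by (rule unscale) (use c0 in simp)
  have "2 *\<^sub>R w1 \<in> L" "2 *\<^sub>R matrix_unit 1 4 \<in> L"
    using add[OF n n''] diff[OF n n''] by (simp_all add: scaleR_2)
  then have w1: "w1 \<in> L" and E14: "matrix_unit 1 4 \<in> L"
    by (auto intro: unscale)

  have "log_y t - (1 - 1 / (2 * t)) *\<^sub>R matrix_unit 2 1 \<in> L"
    using y E21 by (intro diff scale)
  then have m: "matrix_unit 2 3 + d *\<^sub>R matrix_unit 3 1 + matrix_unit 4 1 \<in> L" (is "?m \<in> L")
    by (simp add: log_y_def d_def algebra_simps)
  \<comment> \<open>The bracket with \<open>E12\<close> carries what remains of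
    \<open>log_y t\<close> to \<open>E13 - w2\<close>, with \<open>w2\<close> in the same plane as
    \<open>w1\<close>.\<close>
  have "matrix_unit 1 2 ** ?m - ?m ** matrix_unit 1 2 \<in> L"
    using m E12 by (intro commutator)
  then have m': "matrix_unit 1 3 - w2 \<in> L" (is "?m' \<in> L")
    by (simp add: w2_def matrix_algebra_simps matrix_unit_mult algebra_simps)
  have "?m' ** ?m - ?m ** ?m' \<in> L"
    using m m' by (intro commutator)
  also have "?m' ** ?m - ?m ** ?m'
      = d *\<^sub>R matrix_unit 1 1 + d *\<^sub>R matrix_unit 2 2 - (2 * d) *\<^sub>R matrix_unit 3 3 - 2 *\<^sub>R matrix_unit 4 3"
    (is "_ = ?K'")
    by (simp add: w2_def matrix_algebra_simps matrix_unit_mult) (simp add: vec_eq_iff algebra_simps)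
  finally have "?K' ** ?m' - ?m' ** ?K' \<in> L"
    using m' by (intro commutator)
  also have "?K' ** ?m' - ?m' ** ?K' = (3 * d) *\<^sub>R (matrix_unit 1 3 + w2)"
    by (simp add: w2_def matrix_algebra_simps matrix_unit_mult) (simp add: vec_eq_iff algebra_simps)
  finally have m'': "matrix_unit 1 3 + w2 \<in> L"
    by (rule unscale) (use d0 in simp)
  have "2 *\<^sub>R matrix_unit 1 3 \<in> L" "2 *\<^sub>R w2 \<in> L"
    using add[OF m'' m'] diff[OF m'' m'] by (simp_all add: scaleR_2)
  then have w2: "w2 \<in> L" and E13: "matrix_unit 1 3 \<in> L"
    by (auto intro: unscale)

  \<comment> \<open>Cramer's rule for the pair \<open>w1\<close>, \<open>w2\<close>.\<close>
  have "(1 - c * d) *\<^sub>R matrix_unit 3 2 = w1 - c *\<^sub>R w2"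
    "(1 - c * d) *\<^sub>R matrix_unit 4 2 = w2 - d *\<^sub>R w1"
    by (simp_all add: w1_def w2_def algebra_simps)
  moreover have "w1 - c *\<^sub>R w2 \<in> L" "w2 - d *\<^sub>R w1 \<in> L"
    using w1 w2 by (auto intro: diff scale)
  ultimately have E32: "matrix_unit 3 2 \<in> L" and E42: "matrix_unit 4 2 \<in> L"
    using cd by (metis unscale)+

  have unit_commutator: "matrix_unit p r \<in> L"
    if "matrix_unit p q \<in> L" "matrix_unit q r \<in> L" "p \<noteq> r" for p q r
    using commutator[OF that(1,2)] that(3) by (simp add: matrix_unit_mult)
  \<comment> \<open>\<open>E21\<close> carries the units into row 2 and column 1; the last two,
    \<open>E34\<close> and \<open>E43\<close>, pass through index 1.\<close>
  have E24: "matrix_unit 2 4 \<in> L" and E23: "matrix_unit 2 3 \<in> L"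
    and E31: "matrix_unit 3 1 \<in> L" and E41: "matrix_unit 4 1 \<in> L"
    using unit_commutator[OF E21 E14] unit_commutator[OF E21 E13]
      unit_commutator[OF E32 E21] unit_commutator[OF E42 E21] by simp_all
  have E34: "matrix_unit 3 4 \<in> L" and E43: "matrix_unit 4 3 \<in> L"
    using unit_commutator[OF E31 E14] unit_commutator[OF E41 E13] by simp_all
  have "\<forall>i j. i \<noteq> j \<longrightarrow> matrix_unit i j \<in> L"
    unfolding forall_4
    using E12 E13 E14 E21 E23 E24 E31 E32 E34 E41 E42 E43 by simp
  then show ?thesis
    using \<open>i \<noteq> j\<close> by blast
qed

section \<open>Change of basis and the image of the knot group\<close>

definition adapted_basis :: "real^4^4" where
  "adapted_basis = vector [vector [1, 0, 0, 0],
                           vector [1, 0, 1, 0],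
                           vector [0, 1, 0, 1],
                           vector [0, 1, 0, 0]]"

definition adapted_basis_inv :: "real^4^4" where
  "adapted_basis_inv = vector [vector [1, 0, 0, 0],
                               vector [0, 0, 0, 1],
                               vector [-1, 1, 0, 0],
                               vector [0, 0, 1, -1]]"

lemma adapted_basis_inverse:
  "adapted_basis ** adapted_basis_inv = mat 1" "adapted_basis_inv ** adapted_basis = mat 1"
  by (simp_all add: vec_eq_iff forall_4 matrix_matrix_mult_def sum_4 mat_def adapted_basis_def
      adapted_basis_inv_def)

text \<open>The right factor is the exponential of \<open>log_x t\<close>, a finite sum by
  \<open>log_x_cube\<close>.\<close>

lemma phi_x_adapted_basis:
  "phi_x t ** adapted_basis
    = adapted_basis ** (mat 1 + log_x t + (1/2) *\<^sub>R (log_x t ** log_x t))"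
  unfolding log_x_square
  by (simp add: vec_eq_iff forall_4 matrix_matrix_mult_def sum_4 mat_def adapted_basis_def
      phi_x_def log_x_def matrix_unit_def field_simps)

lemma phi_y_adapted_basis:
  "t \<noteq> 0 \<Longrightarrow> phi_y t ** adapted_basis
    = adapted_basis ** (mat 1 + log_y t + (1/2) *\<^sub>R (log_y t ** log_y t))"
  unfolding log_y_square
  by (simp add: vec_eq_iff forall_4 matrix_matrix_mult_def sum_4 mat_def adapted_basis_def
      phi_y_def log_y_def matrix_unit_def field_simps)

text \<open>Stability under right multiplication by the generators is the form of hypothesis that
  \<open>zariski_lie_unipotent\<close> takes.\<close>

lemma phi_image_closed:
  assumes "t \<noteq> 0"
  shows "mat 1 \<in> phi t ` carrier fig8_group"
    and "g \<in> phi t ` carrier fig8_group \<Longrightarrow> g ** phi_x t \<in> phi t ` carrier fig8_group"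
    and "g \<in> phi t ` carrier fig8_group \<Longrightarrow> g ** phi_y t \<in> phi t ` carrier fig8_group"
proof -
  interpret \<Gamma>: group fig8_group by (rule group_fig8_group)
  note hom = phi_hom[OF assms]
  have "phi t \<one>\<^bsub>fig8_group\<^esub> = mat 1"
    using hom_one[OF hom(1) group_fig8_group group_SL] by (simp add: SL_def)
  then show "mat 1 \<in> phi t ` carrier fig8_group"
    by (metis \<Gamma>.one_closed imageI)
  have closed: "g ** phi t C \<in> phi t ` carrier fig8_group"
    if g: "g \<in> phi t ` carrier fig8_group" and C: "C \<in> carrier fig8_group" for g C
  proof -
    obtain D where D: "D \<in> carrier fig8_group" "g = phi t D"
      using g by blast
    then have "g ** phi t C = phi t (D \<otimes>\<^bsub>fig8_group\<^esub> C)"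
      using hom_mult[OF hom(1) D(1) C] by (simp add: SL_def)
    then show ?thesis
      using D C by (metis \<Gamma>.m_closed imageI)
  qed
  have "fig8_x \<in> carrier fig8_group" "fig8_y \<in> carrier fig8_group"
    by (simp_all add: fig8_group_def presented_group_def)
  then show "g \<in> phi t ` carrier fig8_group \<Longrightarrow> g ** phi_x t \<in> phi t ` carrier fig8_group"
    "g \<in> phi t ` carrier fig8_group \<Longrightarrow> g ** phi_y t \<in> phi t ` carrier fig8_group"
    using closed by (simp_all flip: hom(2,3))
qed

lemma vanishing_on_phi_image:
  assumes t: "t > 0" "t \<noteq> 1/2"
    and p: "real_polynomial_function p" "\<And>g. g \<in> phi t ` carrier fig8_group \<Longrightarrow> p g = 0"
    and A: "det A = 1"
  shows "p A = 0"
proof -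
  let ?P = adapted_basis and ?Q = adapted_basis_inv
  let ?\<Gamma> = "phi t ` carrier fig8_group"
  \<comment> \<open>The image group conjugated into the adapted basis, where the generators become
    exponentials of \<open>log_x t\<close> and \<open>log_y t\<close>.\<close>
  define S where "S = {g. ?P ** g ** ?Q \<in> ?\<Gamma>}"
  have t0: "t \<noteq> 0" using t by simp
  \<comment> \<open>Here \<open>U\<close> is the conjugate \<open>?Q ** X ** ?P\<close>, so
    stability of the image under \<open>X\<close> becomes stability of \<open>S\<close> under
    \<open>U\<close>.\<close>
  have S_mult: "g ** U \<in> S"
    if g: "g \<in> S" and X: "\<And>h. h \<in> ?\<Gamma> \<Longrightarrow> h ** X \<in> ?\<Gamma>" and U: "X ** ?P = ?P ** U" for g U X
  proof -
    have "?P ** (g ** U) ** ?Q = ?P ** g ** (?Q ** ?P) ** U ** ?Q"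
      by (simp add: adapted_basis_inverse matrix_mul_assoc)
    also have "\<dots> = ?P ** g ** ?Q ** (?P ** U) ** ?Q"
      by (simp add: matrix_mul_assoc)
    also have "\<dots> = ?P ** g ** ?Q ** X ** (?P ** ?Q)"
      by (simp add: matrix_mul_assoc flip: U)
    finally show ?thesis
      using g X by (simp add: S_def adapted_basis_inverse)
  qed
  have "log_x t \<in> zariski_lie S"
    using S_mult[OF _ phi_image_closed(2)[OF t0] phi_x_adapted_basis]
    by (intro zariski_lie_unipotent log_x_cube)
  moreover have "log_y t \<in> zariski_lie S"
    using S_mult[OF _ phi_image_closed(3)[OF t0] phi_y_adapted_basis[OF t0]]
    by (intro zariski_lie_unipotent log_y_cube)
  ultimately have "matrix_unit i j \<in> zariski_lie S" if "i \<noteq> j" for i j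
    using that by (intro matrix_unit_in_generated_lie_algebra[OF t])
      (auto intro: zariski_lie_add zariski_lie_scaleR zariski_lie_commutator)
  moreover have "mat 1 \<in> S"
    using phi_image_closed(1)[OF t0] by (simp add: S_def adapted_basis_inverse)
  moreover have "polynomial_function (\<lambda>g. ?P ** g ** ?Q)"
    by (intro polynomial_function_bounded_linear bounded_linear_compose[OF matrix_mult.bounded_linear_left]
        matrix_mult.bounded_linear_right)
  then have "(\<lambda>g. p (?P ** g ** ?Q)) \<in> vanishing_polys S"
    using real_polynomial_function_compose[OF _ p(1)] p(2)
    by (auto simp: vanishing_polys_def S_def o_def)
  moreover have "det ?Q * det ?P = 1"
    by (simp add: adapted_basis_inverse flip: det_mul)
  then have "det (?Q ** A ** ?P) = 1"
    using A by (simp add: det_mul)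
  \<comment> \<open>Evaluation at the conjugate of \<open>A\<close>, so that conjugating back yields
    \<open>p A\<close>.\<close>
  ultimately have "p (?P ** (?Q ** A ** ?P) ** ?Q) = 0"
    by (rule vanishing_polys_SL)
  moreover have "?P ** (?Q ** A ** ?P) ** ?Q = (?P ** ?Q) ** A ** (?P ** ?Q)"
    by (simp only: matrix_mul_assoc)
  ultimately show ?thesis
    by (simp add: adapted_basis_inverse)
qed

theorem theorem4p3:
  fixes t :: real
  assumes "t > 0" and "t \<noteq> 1 / 2"
  shows "Gt t = carrier SL \<and> zariski_dense (phi t ` carrier fig8_group)"
proof -
  let ?\<Gamma> = "phi t ` carrier fig8_group"
  let ?G = "Abstract_Topology.closure_of zariski_SL ?\<Gamma>"
  have top: "topspace zariski_SL = carrier SL"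
    by (simp add: zariski_SL_def)
  have "?\<Gamma> \<subseteq> carrier SL"
    using phi_hom(1)[of t] assms by (auto simp: hom_def)
  then have sub: "?\<Gamma> \<subseteq> ?G"
    by (simp add: closure_of_subset top)
  \<comment> \<open>The closure is cut out in \<open>carrier SL\<close> by polynomials vanishing on
    the image; each of these vanishes on all of \<open>carrier SL\<close>.\<close>
  have "closedin (subtopology zariski_topology (carrier SL)) ?G"
    using closedin_closure_of[of zariski_SL ?\<Gamma>] by (simp add: zariski_SL_def)
  then obtain P where P: "\<forall>p\<in>P. real_polynomial_function p" and G: "?G = zero_locus P \<inter> carrier SL"
    unfolding closedin_subtopology closedin_zariski_iff by blast
  have "p A = 0" if "p \<in> P" "A \<in> carrier SL" for p A
  proof (rule vanishing_on_phi_image[OF assms])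
    show "real_polynomial_function p" using P that by blast
    show "p g = 0" if "g \<in> ?\<Gamma>" for g
      using sub G \<open>p \<in> P\<close> that by (auto simp: zero_locus_def)
    show "det A = 1" using that by (simp add: SL_def)
  qed
  then have "?G = carrier SL"
    unfolding G by (auto simp: zero_locus_def)
  then show ?thesis
    by (simp add: Gt_def zariski_dense_def top)
qed

end
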